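(* Let $\gamma\subset\mathbb{C}$ be a compact simple (open or closed) curve such that $\gamma$ intersects every origin centred circle in at most two points. Let $f:\gamma\to\mathbb{C}$ be a continuous function and suppose $\epsilon>0$. Then there exists a polynomial $p\in\mathcal{P}(r2)$ such that $$\max_{z\in\gamma}|f(z)-p(z)|<\epsilon.$$
   Context: A compact simple open curve is a homeomorphic image in $\mathbb{C}$ of a compact interval $[0,1]$ (a simple arc, "open" meaning not closed up); a compact simple closed curve is a homeomorphic image in $\mathbb{C}$ of the unit circle. $\mathcal{P}(r2)=\bigcup_{j\ge0}\mathcal{P}_j(r2)$, where $\mathcal{P}_j(r2)$ is the set of functions of $\lambda\in\mathbb{C}$ of the form $\sum_{k=0}^{\lfloor j/2\rfloor}(\alpha_{2k}+\alpha_{2k+1}\lambda)|\lambda|^{2k}$ with $\alpha_k\in\mathbb{C}$, where $\alpha_{j+1}=0$ if $j$ is even. *)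

theory Defs
  imports "HOL-Analysis.Analysis"
begin

definition compact_simple_open_curve :: "complex set \<Rightarrow> bool" where
  "compact_simple_open_curve \<gamma> \<longleftrightarrow> {0..1::real} homeomorphic \<gamma>"

definition compact_simple_closed_curve :: "complex set \<Rightarrow> bool" where
  "compact_simple_closed_curve \<gamma> \<longleftrightarrow> sphere (0::complex) 1 homeomorphic \<gamma>"

text \<open>The coefficients are a total sequence, of which only the entries up to
  \<open>2 * (j div 2) + 1\<close> matter. For even \<open>j\<close> the last of them has index \<open>j + 1\<close>, and it is required
  to vanish; for odd \<open>j\<close> it has index \<open>j\<close>.\<close>

definition P_r2_deg :: "nat \<Rightarrow> (complex \<Rightarrow> complex) set" where
  "P_r2_deg j = {p. \<exists>\<alpha>::nat \<Rightarrow> complex. (even j \<longrightarrow> \<alpha> (j + 1) = 0) \<and>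
     p = (\<lambda>z. \<Sum>k=0..j div 2. (\<alpha> (2 * k) + \<alpha> (2 * k + 1) * z) * complex_of_real (cmod z ^ (2 * k)))}"

definition P_r2 :: "(complex \<Rightarrow> complex) set" where
  "P_r2 = (\<Union>j. P_r2_deg j)"

end

(* Read |z|^2 as a map to the real line whose fibres on the curve have at most two points. On each
   fibre f agrees with some a + b * z, and by compactness this stays a good approximation over a
   neighbourhood of the fibre. A partition of unity in |z|^2 glues these local approximations to
   A(|z|^2) + B(|z|^2) * z with A and B continuous, and Weierstrass replaces A and B by polynomials. *)
theory Submission
  imports Defs
begin

text \<open>The local approximations have constant coefficients, and gluing them with weights that
  depend on \<open>t\<close> alone yields coefficients that are functions of \<open>t\<close>. Exact
  agreement on single fibres is thus enough for uniform approximation on \<open>K\<close>.\<close>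

lemma fibrewise_affine_approximation:
  fixes K :: "'a::topological_space set" and t :: "'a \<Rightarrow> real" and f h :: "'a \<Rightarrow> complex"
  assumes K: "compact K" and t: "continuous_on K t" and f: "continuous_on K f"
    and h: "continuous_on K h" and e: "e > 0"
    and fibre: "\<And>s. \<exists>a b. \<forall>z\<in>K. t z = s \<longrightarrow> f z = a + b * h z"
  obtains A B :: "real \<Rightarrow> complex" where "continuous_on (t ` K) A" "continuous_on (t ` K) B"
    "\<And>z. z \<in> K \<Longrightarrow> cmod (f z - (A (t z) + B (t z) * h z)) < e"
proof -
  define \<V> where
    "\<V> = {V. open V \<and> (\<exists>a b. \<forall>z\<in>K. t z \<in> V \<longrightarrow> cmod (f z - (a + b * h z)) < e)}"
  have cover: "\<exists>V\<in>\<V>. s \<in> V" for s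
  proof -
    from fibre[of s] obtain a b where ab: "\<And>z. z \<in> K \<Longrightarrow> t z = s \<Longrightarrow> f z = a + b * h z"
      by blast
    \<comment> \<open>\<open>C\<close> is the set of bad points. It is compact, so its image under
      \<open>t\<close> is closed, and the complement of that image is a neighbourhood of
      \<open>s\<close> whose entire preimage in \<open>K\<close> is good.\<close>
    define C where "C = K \<inter> (\<lambda>z. cmod (f z - (a + b * h z))) -` {e..}"
    have "continuous_on K (\<lambda>z. cmod (f z - (a + b * h z)))"
      by (intro continuous_intros f h)
    then have "compact C"
      unfolding C_def by (intro closedin_compact[OF K] continuous_closedin_preimage closed_atLeast)
    moreover have "C \<subseteq> K"
      by (auto simp: C_def)
    ultimately have "compact (t ` C)"
      using t by (meson compact_continuous_image continuous_on_subset)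
    then have "open (- (t ` C))"
      by (simp add: compact_imp_closed open_Compl)
    moreover have "cmod (f z - (a + b * h z)) < e" if "z \<in> K" "t z \<in> - (t ` C)" for z
      using that by (force simp: C_def)
    ultimately have "- (t ` C) \<in> \<V>"
      unfolding \<V>_def by blast
    moreover have "s \<in> - (t ` C)"
      using ab e by (force simp: C_def)
    ultimately show ?thesis by blast
  qed
  have "compact (t ` K)"
    using t K by (rule compact_continuous_image)
  moreover have "t ` K \<subseteq> \<Union>\<V>"
    using cover by blast
  moreover have "\<And>V. V \<in> \<V> \<Longrightarrow> open V"
    by (auto simp: \<V>_def)
  ultimately obtain \<D> where \<D>: "\<D> \<subseteq> \<V>" "finite \<D>" "t ` K \<subseteq> \<Union>\<D>"
    by (metis compactE)
  have "\<forall>V\<in>\<D>. \<exists>ab. \<forall>z\<in>K. t z \<in> V \<longrightarrow> cmod (f z - (fst ab + snd ab * h z)) < e"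
    using \<D>(1) by (fastforce simp: \<V>_def)
  then obtain ab where ab: "\<And>V z. V \<in> \<D> \<Longrightarrow> z \<in> K \<Longrightarrow> t z \<in> V \<Longrightarrow>
      cmod (f z - (fst (ab V) + snd (ab V) * h z)) < e"
    by metis
  have lf: "\<exists>V. open V \<and> x \<in> V \<and> finite {U \<in> \<D>. U \<inter> V \<noteq> {}}" for x
    using \<D>(2) by (intro exI[of _ UNIV]) simp
  have open_\<D>: "open V" if "V \<in> \<D>" for V
    using that \<D>(1) by (auto simp: \<V>_def)
  obtain F where F: "\<And>U. U \<in> \<D> \<Longrightarrow> continuous_on (t ` K) (F U) \<and> (\<forall>x\<in>t ` K. (0::real) \<le> F U x)"
    and F_zero: "\<And>x U. U \<in> \<D> \<Longrightarrow> x \<in> t ` K \<Longrightarrow> x \<notin> U \<Longrightarrow> F U x = 0"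
    and F_supp: "\<And>x. x \<in> t ` K \<Longrightarrow> supp_sum (\<lambda>W. F W x) \<D> = 1"
    by (rule subordinate_partition_of_unity[OF \<D>(3) open_\<D> lf]) blast+
  have F_cont: "continuous_on (t ` K) (F U)" if "U \<in> \<D>" for U
    using F[OF that] by simp
  have F_nonneg: "0 \<le> F U x" if "U \<in> \<D>" "x \<in> t ` K" for U x
    using F[OF that(1)] that(2) by blast
  have F_one: "(\<Sum>U\<in>\<D>. F U x) = 1" if "x \<in> t ` K" for x
  proof -
    \<comment> \<open>\<open>supp_sum\<close> runs over the nonzero terms only; as
      \<open>\<D>\<close> is finite, this is the plain sum.\<close>
    have "(\<Sum>U | U \<in> \<D> \<and> F U x \<noteq> 0. F U x) = (\<Sum>U\<in>\<D>. F U x)"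
      using \<D>(2) by (intro sum.mono_neutral_left) auto
    then show ?thesis
      using F_supp[OF that] unfolding supp_sum_def support_on_def by argo
  qed
  define A where "A = (\<lambda>x. \<Sum>U\<in>\<D>. of_real (F U x) * fst (ab U))"
  define B where "B = (\<lambda>x. \<Sum>U\<in>\<D>. of_real (F U x) * snd (ab U))"
  have "cmod (f z - (A (t z) + B (t z) * h z)) < e" if z: "z \<in> K" for z
  proof -
    define d where "d = (\<lambda>U. f z - (fst (ab U) + snd (ab U) * h z))"
    have tz: "t z \<in> t ` K" using z by simp
    \<comment> \<open>The weights sum to 1, so the global error is a convex combination of the local
      errors \<open>d U\<close>.\<close>
    have "(\<Sum>U\<in>\<D>. of_real (F U (t z)) * d U) =
        (\<Sum>U\<in>\<D>. of_real (F U (t z))) * f z - (A (t z) + B (t z) * h z)"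
      by (simp add: A_def B_def d_def right_diff_distrib distrib_left sum.distrib sum_subtractf
          sum_distrib_right mult.assoc)
    also have "(\<Sum>U\<in>\<D>. complex_of_real (F U (t z))) = 1"
      using F_one[OF tz] by (simp flip: of_real_sum)
    finally have "f z - (A (t z) + B (t z) * h z) = (\<Sum>U\<in>\<D>. of_real (F U (t z)) * d U)"
      by simp
    then have le: "cmod (f z - (A (t z) + B (t z) * h z)) \<le> (\<Sum>U\<in>\<D>. F U (t z) * cmod (d U))"
      using F_nonneg[OF _ tz] by (auto intro!: sum_norm_le simp: norm_mult)
    have pointwise: "F U (t z) * cmod (d U) \<le> F U (t z) * e" if "U \<in> \<D>" for U
      using that F_nonneg[OF that tz] F_zero[OF that tz] ab[OF that z]
      by (cases "t z \<in> U") (simp_all add: d_def mult_left_mono)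
    \<comment> \<open>Strictness of the final bound comes from one index with positive weight: there
      \<open>t z\<close> lies in \<open>U\<close>, so the local error is strictly below
      \<open>e\<close>.\<close>
    obtain U where U: "U \<in> \<D>" "F U (t z) \<noteq> 0"
      using F_one[OF tz] by (metis sum.neutral zero_neq_one)
    have "F U (t z) * cmod (d U) < F U (t z) * e"
    proof (rule mult_strict_left_mono)
      show "cmod (d U) < e"
        using U F_zero[OF U(1) tz] ab[OF U(1) z] by (auto simp: d_def)
      show "0 < F U (t z)"
        using U F_nonneg[OF U(1) tz] by simp
    qed
    then have "(\<Sum>U\<in>\<D>. F U (t z) * cmod (d U)) < (\<Sum>U\<in>\<D>. F U (t z) * e)"
      using \<D>(2) U(1) pointwise by (intro sum_strict_mono_ex1) auto
    also have "\<dots> = e"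
      using F_one[OF tz] by (simp flip: sum_distrib_right)
    finally show ?thesis using le by simp
  qed
  moreover have "continuous_on (t ` K) A" "continuous_on (t ` K) B"
    unfolding A_def B_def by (intro continuous_intros F_cont; simp)+
  ultimately show ?thesis using that by blast
qed

text \<open>Restates Weierstrass with the type \<open>poly\<close>, whose coefficients are later
  read off to build a member of \<open>P_r2\<close>.\<close>

lemma real_Weierstrass_poly:
  fixes g :: "real \<Rightarrow> real"
  assumes "compact S" "continuous_on S g" "e > 0"
  obtains p :: "real poly" where "\<And>x. x \<in> S \<Longrightarrow> \<bar>g x - poly p x\<bar> < e"
proof -
  obtain q where q: "real_polynomial_function q" "\<And>x. x \<in> S \<Longrightarrow> \<bar>g x - q x\<bar> < e"
    using Stone_Weierstrass_real_polynomial_function[OF assms] by blast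
  then obtain a n where "q = (\<lambda>x. \<Sum>i\<le>n. a i * x ^ i)"
    using real_polynomial_function_iff_sum by blast
  then have "q x = poly (\<Sum>i\<le>n. monom (a i) i) x" for x
    by (simp add: poly_sum poly_monom)
  then show ?thesis using q(2) that by metis
qed

text \<open>Real and imaginary parts are approximated separately within \<open>e / 2\<close>; the
  modulus is at most the sum of the absolute values of the two parts.\<close>

lemma complex_Weierstrass_poly:
  fixes g :: "real \<Rightarrow> complex"
  assumes S: "compact S" and g: "continuous_on S g" and e: "e > 0"
  obtains p :: "complex poly" where "\<And>x. x \<in> S \<Longrightarrow> cmod (g x - poly p (of_real x)) < e"
proof -
  have e2: "e / 2 > 0" using e by simp
  obtain u where u: "\<And>x. x \<in> S \<Longrightarrow> \<bar>Re (g x) - poly u x\<bar> < e / 2"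
    using real_Weierstrass_poly[OF S continuous_on_Re[OF g] e2] by blast
  obtain v where v: "\<And>x. x \<in> S \<Longrightarrow> \<bar>Im (g x) - poly v x\<bar> < e / 2"
    using real_Weierstrass_poly[OF S continuous_on_Im[OF g] e2] by blast
  define p where "p = map_poly complex_of_real u + smult \<i> (map_poly complex_of_real v)"
  have "poly (map_poly complex_of_real q) (of_real x) = of_real (poly q x)" for q x
    by (induction q) (auto simp: map_poly_pCons)
  then have "poly p (of_real x) = Complex (poly u x) (poly v x)" for x
    by (simp add: p_def complex_eq_iff)
  then have "cmod (g x - poly p (of_real x)) < e" if "x \<in> S" for x
    using cmod_le[of "g x - poly p (of_real x)"] u[OF that] v[OF that] by simp
  then show ?thesis using that by blast
qed

text \<open>The coefficients of \<open>A\<close> become the even entries of \<alpha> and those of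
  \<open>B\<close> the odd ones, both padded with zeros up to the larger degree.\<close>

lemma P_r2_poly:
  "(\<lambda>z. poly A (of_real ((cmod z)\<^sup>2)) + poly B (of_real ((cmod z)\<^sup>2)) * z) \<in> P_r2"
proof -
  define m where "m = max (degree A) (degree B)"
  define \<alpha> where "\<alpha> n = (if even n then coeff A (n div 2) else coeff B (n div 2))" for n
  have "poly A x = (\<Sum>k=0..m. coeff A k * x ^ k)" "poly B x = (\<Sum>k=0..m. coeff B k * x ^ k)" for x
    by (auto simp: m_def poly_altdef simp flip: atMost_atLeast0
        intro!: sum.mono_neutral_left le_degree)
  then have "poly A (of_real ((cmod z)\<^sup>2)) + poly B (of_real ((cmod z)\<^sup>2)) * z =
      (\<Sum>k=0..(2 * m + 1) div 2.
        (\<alpha> (2 * k) + \<alpha> (2 * k + 1) * z) * complex_of_real (cmod z ^ (2 * k)))" for z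
    by (simp add: \<alpha>_def distrib_right sum.distrib sum_distrib_left sum_distrib_right mult_ac
        flip: power_mult)
  \<comment> \<open>The odd index \<open>2 * m + 1\<close> makes the vanishing condition on \<alpha>
    vacuous, while its half rounds down to \<open>m\<close>.\<close>
  then have "(\<lambda>z. poly A (of_real ((cmod z)\<^sup>2)) + poly B (of_real ((cmod z)\<^sup>2)) * z)
      \<in> P_r2_deg (2 * m + 1)"
    unfolding P_r2_deg_def by (intro CollectI exI[of _ \<alpha>]) auto
  then show ?thesis unfolding P_r2_def by blast
qed

lemma affine_interpolation_card_le_2:
  fixes f :: "'a::field \<Rightarrow> 'a"
  assumes "finite S" "card S \<le> 2"
  shows "\<exists>a b. \<forall>z\<in>S. f z = a + b * z"
proof -
  consider "S = {}" | x where "S = {x}" | x y where "x \<noteq> y" "S = {x, y}"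
  proof -
    have "card S = 0 \<or> card S = 1 \<or> card S = 2" using assms(2) by linarith
    then show thesis
      using that assms(1) by (metis card_0_eq card_1_singletonE card_2_iff)
  qed
  then show ?thesis
  proof cases
    case 1
    then show ?thesis by simp
  next
    case (2 x)
    then show ?thesis by (intro exI[of _ "f x"] exI[of _ 0]) simp
  next
    case (3 x y)
    \<comment> \<open>The slope of the line through the two points of the graph.\<close>
    define b where "b = (f y - f x) / (y - x)"
    have "f y = (f x - b * x) + b * y"
    proof -
      have "b * (y - x) = f y - f x" using 3(1) by (simp add: b_def)
      then show ?thesis by (simp add: algebra_simps)
    qed
    with 3(2) show ?thesis by (intro exI[of _ "f x - b * x"] exI[of _ b]) simp
  qed
qed

lemma P_r2_dense:
  fixes K :: "complex set" and f :: "complex \<Rightarrow> complex"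
  assumes K: "compact K"
    and card: "\<And>r::real. r > 0 \<Longrightarrow> finite (K \<inter> sphere 0 r) \<and> card (K \<inter> sphere 0 r) \<le> 2"
    and f: "continuous_on K f" and e: "e > 0"
  obtains p where "p \<in> P_r2" "continuous_on K p" "\<And>z. z \<in> K \<Longrightarrow> cmod (f z - p z) < e"
proof -
  \<comment> \<open>The square is used because \<open>P_r2\<close> contains only even powers of the
    modulus; the level sets are the same circles.\<close>
  define t where "t = (\<lambda>z. (cmod z)\<^sup>2)"
  have t: "continuous_on K t"
    unfolding t_def by (intro continuous_intros)
  have fibre: "\<exists>a b. \<forall>z\<in>K. t z = s \<longrightarrow> f z = a + b * z" for s
  proof (cases "s > 0")
    case True
    then have "z \<in> K \<and> t z = s \<longrightarrow> z \<in> K \<inter> sphere 0 (sqrt s)" for z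
      by (auto simp: t_def)
    with affine_interpolation_card_le_2[of "K \<inter> sphere 0 (sqrt s)" f] card[of "sqrt s"] True
    show ?thesis by (metis real_sqrt_gt_zero)
  next
    case False
    \<comment> \<open>For \<open>s\<close> not positive the fibre is at most the origin, which the
      circle hypothesis does not mention; the constant \<open>f 0\<close> interpolates
      there.\<close>
    then have "t z = s \<longrightarrow> z = 0" for z
      by (auto simp: t_def not_less)
    then show ?thesis by (intro exI[of _ "f 0"] exI[of _ 0]) auto
  qed
  have e3: "e / 3 > 0" using e by simp
  obtain A B where A: "continuous_on (t ` K) A" and B: "continuous_on (t ` K) B"
    and AB: "\<And>z. z \<in> K \<Longrightarrow> cmod (f z - (A (t z) + B (t z) * z)) < e / 3"
    using fibrewise_affine_approximation[OF K t f continuous_on_id e3 fibre] by blast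
  have tK: "compact (t ` K)"
    using t K by (rule compact_continuous_image)
  obtain R where R: "R > 0" "\<And>z. z \<in> K \<Longrightarrow> cmod z \<le> R"
    using K by (meson bounded_pos compact_imp_bounded)
  obtain P where P: "\<And>x. x \<in> t ` K \<Longrightarrow> cmod (A x - poly P (of_real x)) < e / 3"
    using complex_Weierstrass_poly[OF tK A e3] by blast
  \<comment> \<open>The error in \<open>B\<close> gets multiplied by \<open>z\<close>, whose modulus
    is at most \<open>R\<close>, so this tolerance costs at most \<open>e / 3\<close>. The gluing
    and the approximation of \<open>A\<close> take the other two thirds.\<close>
  have eR: "e / (3 * R) > 0" using e R by simp
  obtain Q where Q: "\<And>x. x \<in> t ` K \<Longrightarrow> cmod (B x - poly Q (of_real x)) < e / (3 * R)"
    using complex_Weierstrass_poly[OF tK B eR] by blast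
  define p where "p z = poly P (of_real (t z)) + poly Q (of_real (t z)) * z" for z
  have "cmod (f z - p z) < e" if z: "z \<in> K" for z
  proof -
    define u where "u = f z - (A (t z) + B (t z) * z)"
    define v where "v = A (t z) - poly P (of_real (t z))"
    define w where "w = B (t z) - poly Q (of_real (t z))"
    have "f z - p z = u + v + w * z"
      by (simp add: p_def u_def v_def w_def algebra_simps)
    then have "cmod (f z - p z) \<le> cmod u + cmod v + cmod (w * z)"
      by (metis norm_triangle_le norm_triangle_ineq add_right_mono)
    moreover have "cmod (w * z) \<le> e / (3 * R) * R"
      unfolding norm_mult using Q[of "t z"] R z e
      by (intro mult_mono) (auto simp: w_def intro: less_imp_le)
    moreover have "e / (3 * R) * R = e / 3" using R by simp
    ultimately show ?thesis
      using AB[OF z] P[of "t z"] z by (simp add: u_def v_def)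
  qed
  moreover have "p \<in> P_r2"
    using P_r2_poly[of P Q] by (simp add: p_def[abs_def] t_def)
  moreover have "continuous_on K p"
    unfolding p_def[abs_def] t_def by (intro continuous_intros)
  ultimately show ?thesis using that by blast
qed

theorem theorem4p5:
  fixes \<gamma> :: "complex set" and f :: "complex \<Rightarrow> complex" and \<epsilon> :: real
  assumes "compact_simple_open_curve \<gamma> \<or> compact_simple_closed_curve \<gamma>"
    and "\<And>r::real. r > 0 \<Longrightarrow> finite (\<gamma> \<inter> sphere 0 r) \<and> card (\<gamma> \<inter> sphere 0 r) \<le> 2"
    and "continuous_on \<gamma> f"
    and "\<epsilon> > 0"
  shows "\<exists>p\<in>P_r2. \<exists>z\<^sub>0\<in>\<gamma>. (\<forall>z\<in>\<gamma>. cmod (f z - p z) \<le> cmod (f z\<^sub>0 - p z\<^sub>0)) \<and>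
           cmod (f z\<^sub>0 - p z\<^sub>0) < \<epsilon>"
proof -
  consider "{0..1::real} homeomorphic \<gamma>" | "sphere (0::complex) 1 homeomorphic \<gamma>"
    using assms(1) unfolding compact_simple_open_curve_def compact_simple_closed_curve_def by blast
  then have \<gamma>: "compact \<gamma>" "\<gamma> \<noteq> {}"
    using homeomorphic_compactness[of "{0..1::real}" \<gamma>]
      homeomorphic_compactness[of "sphere (0::complex) 1" \<gamma>]
    by (cases; auto)+
  obtain p where p: "p \<in> P_r2" "continuous_on \<gamma> p" "\<And>z. z \<in> \<gamma> \<Longrightarrow> cmod (f z - p z) < \<epsilon>"
    using P_r2_dense[OF \<gamma>(1) assms(2-4)] by blast
  \<comment> \<open>On the nonempty compact curve the continuous error attains its maximum, and the
    strict pointwise bound holds at the maximiser too.\<close>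
  have "continuous_on \<gamma> (\<lambda>z. cmod (f z - p z))"
    using assms(3) p(2) by (intro continuous_intros)
  then obtain z\<^sub>0 where "z\<^sub>0 \<in> \<gamma>" "\<forall>z\<in>\<gamma>. cmod (f z - p z) \<le> cmod (f z\<^sub>0 - p z\<^sub>0)"
    using continuous_attains_sup[OF \<gamma>] by blast
  with p(1,3) show ?thesis by blast
qed

end
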